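(* In a (C1)-Jordan pair $(V^+,V^-)$, the quasi-inversion map $$(V^+\times V^-)^\times\to V^+\times V^-,\quad (x,a)\mapsto(x^a,a^x)=(e^{\mathrm{ad}(a)}.x,\ e^{\mathrm{ad}(x)}.a)$$ is smooth, and in a (C2)-Jordan pair the partial maps $$U_a\to V^+,\ x\mapsto e^{\mathrm{ad}(a)}.x=x^a\quad(a\in V^-),\qquad U_x\to V^-,\ a\mapsto e^{\mathrm{ad}(x)}.a=a^x\quad(x\in V^+)$$ are smooth.
   Context: $\mathbb{K}$ is a commutative topological ring with unit $1$ (ring operations continuous, unit group $\mathbb{K}^\times$ open, inversion on $\mathbb{K}^\times$ continuous) such that $\mathbb{K}^\times$ is dense in $\mathbb{K}$ and $2$ is invertible. Topological $\mathbb{K}$-modules are assumed Hausdorff; $C^0$ means continuous. For topological $\mathbb{K}$-modules $V,W$ and $U\subset V$ open, $f:U\to W$ is $C^1$ if there is a continuous map $f^{[1]}:\{(x,v,t)\in U\times V\times\mathbb{K}: x+tv\in U\}\to W$ with $f(x+tv)-f(x)=t\,f^{[1]}(x,v,t)$; $f$ is $C^{k+1}$ if it is $C^1$ and $f^{[1]}$ is $C^k$; smooth means $C^k$ for all $k$. A (linear) Jordan pair $(V^+,V^-)$ is a pair of $\mathbb K$-modules with trilinear maps $T^\pm:V^\pm\times V^\mp\times V^\pm\to V^\pm$ (write $T^\pm(x,y)z=T^\pm(x,y,z)$) with $T^\pm(x,y,z)=T^\pm(z,y,x)$ and $T^\pm(x,y)T^\pm(u,v,w)=T^\pm(T^\pm(x,y)u,v,w)-T^\pm(u,T^\mp(y,x)v,w)+T^\pm(u,v,T^\pm(x,y)w)$.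 Equivalently, $V^\pm=\mathfrak g_{\pm1}$ for a 3-graded Lie algebra $\mathfrak g=\mathfrak g_1\oplus\mathfrak g_0\oplus\mathfrak g_{-1}$ with inner grading derivation, with $T^\pm(x,y,z)=-[[x,y],z]$. It is topological if $V^\pm$ are topological $\mathbb K$-modules and $T^\pm$ are continuous. Put $Q^\pm(x)y=\frac12T^\pm(x,y,x)$, and for $x\in V^+$, $a\in V^-$ define the Bergman operators $B_+(x,a)v=v-T^+(x,a,v)+Q^+(x)Q^-(a)v$ on $V^+$ and $B_-(a,x)b=b-T^-(a,x,b)+Q^-(a)Q^+(x)b$ on $V^-$. Set $(V^+\times V^-)^\times=\{(x,a):B_+(x,a),B_-(a,x)\text{ invertible}\}$, and for fixed $a\in V^-$ (resp. $x\in V^+$) $U_a=\{x\in V^+:(x,a)\in(V^+\times V^-)^\times\}$ (resp. $U_x=\{a\in V^-:(x,a)\in(V^+\times V^-)^\times\}$). (C1): $(V^+\times V^-)^\times$ is open in $V^+\times V^-$ and $(V^+\times V^-)^\times\times V^+\times V^-\to V^+\times V^-$, $(x,a,v,b)\mapsto(B_+(x,a)^{-1}v,B_-(a,x)^{-1}b)$ is continuous. (C2): for every $a\in V^-$, $U_a$ is open in $V^+$ and $U_a\times V^+\to V^+$, $(x,v)\mapsto B_+(x,a)^{-1}v$ is continuous; and dually, for every $x\in V^+$, $U_x$ is open in $V^-$ and $U_x\times V^-\to V^-$, $(a,b)\mapsto B_-(a,x)^{-1}b$ is continuous. A (C1)- (resp. (C2)-) Jordan pair is a topological Jordan pair satisfying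 (C1) (resp. (C2)). For $(x,a)\in(V^+\times V^-)^\times$ the quasi-inverses are $x^a=B_+(x,a)^{-1}(x-Q^+(x)a)\in V^+$ and $a^x=B_-(a,x)^{-1}(a-Q^-(a)x)\in V^-$. They are the values $e^{\mathrm{ad}(a)}.x$ and $e^{\mathrm{ad}(x)}.a$ of the action of the group generated by all $e^{\mathrm{ad}(y)}=1+\mathrm{ad}(y)+\frac12\mathrm{ad}(y)^2$ ($y\in\mathfrak g_{\pm1}$) on the projective completions of $V^+$ and $V^-$; these formulas may be taken as the definition. *)

theory Defs
  imports "HOL-Analysis.Analysis"
begin

section \<open>Base ring and topological modules\<close>

definition unit_inv :: "'k::comm_ring_1 \<Rightarrow> 'k" where
  "unit_inv a = (THE b. a * b = 1)"

locale dense_unit_ring =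
  fixes ring_type :: "'k::{comm_ring_1,topological_ab_group_add,topological_semigroup_mult} itself"
  assumes open_units: "open {a::'k. a dvd 1}"
    and continuous_unit_inv: "continuous_on {a::'k. a dvd 1} unit_inv"
    and dense_units: "closure {a::'k. a dvd 1} = UNIV"
    and two_unit: "(2::'k) dvd 1"

locale topological_module = module scale
  for scale :: "'k::{comm_ring_1,topological_ab_group_add,topological_semigroup_mult} \<Rightarrow>
      'v::{topological_ab_group_add,t2_space} \<Rightarrow> 'v" +
  assumes continuous_scale: "continuous_on UNIV (\<lambda>(t, v). scale t v)"

section \<open>Differentiability over a topological ring\<close>

text \<open>
  The map \<open>f\<^sup>[\<^sup>1\<^sup>]\<close> lives on a subset of \<open>V \<times> V \<times> K\<close>, so the recursion defining
  \<open>C\<^sup>k\<close> changes the type of the domain. To write it as one recursion, the iterated modules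
  \<open>V\<^sub>0 = V\<close>, \<open>V\<^sub>n\<^sub>+\<^sub>1 = V\<^sub>n \<times> V\<^sub>n \<times> K\<close> are collected in a single datatype; \<open>V\<^sub>n\<close> is the
  set of trees all of whose \<open>Base\<close> leaves have depth \<open>n\<close>, and it is the topological space of
  \<open>tower_top n\<close>. The operations below are only used on two elements of the same \<open>V\<^sub>n\<close>.
\<close>

datatype ('v, 'k) tower =
    Base (base: 'v)
  | Ext (point: "('v, 'k) tower") (direction: "('v, 'k) tower") (param: 'k)

fun tower_add :: "('v::ab_group_add, 'k::comm_ring_1) tower \<Rightarrow> ('v, 'k) tower \<Rightarrow> ('v, 'k) tower"
where
  "tower_add (Base v) (Base w) = Base (v + w)"
| "tower_add (Ext x v t) (Ext y w s) = Ext (tower_add x y) (tower_add v w) (t + s)"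

primrec tower_scale ::
  "('k::comm_ring_1 \<Rightarrow> 'v \<Rightarrow> 'v) \<Rightarrow> 'k \<Rightarrow> ('v, 'k) tower \<Rightarrow> ('v, 'k) tower"
where
  "tower_scale sV c (Base v) = Base (sV c v)"
| "tower_scale sV c (Ext x v t) = Ext (tower_scale sV c x) (tower_scale sV c v) (c * t)"

primrec tower_top :: "nat \<Rightarrow> ('v::topological_space, 'k::topological_space) tower topology"
where
  "tower_top 0 = pullback_topology (range Base) base euclidean"
| "tower_top (Suc n) =
     pullback_topology {Ext x v t | x v t. True} (\<lambda>p. (point p, direction p, param p))
       (prod_topology (tower_top n) (prod_topology (tower_top n) euclidean))"

definition ext_domain ::
  "('k::{comm_ring_1,topological_space} \<Rightarrow> 'v::{ab_group_add,topological_space} \<Rightarrow> 'v) \<Rightarrow> nat \<Rightarrow>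
    ('v, 'k) tower set \<Rightarrow> ('v, 'k) tower set"
where
  "ext_domain sV n U =
    {Ext x v t | x v t. x \<in> U \<and> v \<in> topspace (tower_top n) \<and> tower_add x (tower_scale sV t v) \<in> U}"

text \<open>\<open>tower_Ck sV sW k n U f\<close>: the map \<open>f : U \<rightarrow> W\<close>, with \<open>U \<subseteq> V\<^sub>n\<close>, is \<open>C\<^sup>k\<close>. For the sets \<open>U\<close> of
  interest (open, \<open>W\<close> Hausdorff) the witness \<open>g\<close> is unique on \<open>ext_domain sV n U\<close>, since the
  units are dense.\<close>

primrec tower_Ck ::
  "('k::{comm_ring_1,topological_space} \<Rightarrow> 'v::{ab_group_add,topological_space} \<Rightarrow> 'v) \<Rightarrow>
   ('k \<Rightarrow> 'w::{ab_group_add,topological_space} \<Rightarrow> 'w) \<Rightarrow>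
   nat \<Rightarrow> nat \<Rightarrow> ('v, 'k) tower set \<Rightarrow> (('v, 'k) tower \<Rightarrow> 'w) \<Rightarrow> bool"
where
  "tower_Ck sV sW 0 = (\<lambda>n U f. continuous_map (subtopology (tower_top n) U) euclidean f)"
| "tower_Ck sV sW (Suc k) = (\<lambda>n U f.
     \<exists>g. continuous_map (subtopology (tower_top (Suc n)) (ext_domain sV n U)) euclidean g \<and>
       (\<forall>x v t. Ext x v t \<in> ext_domain sV n U \<longrightarrow>
          f (tower_add x (tower_scale sV t v)) - f x = sW t (g (Ext x v t))) \<and>
       tower_Ck sV sW k (Suc n) (ext_domain sV n U) g)"

definition Ck_on ::
  "('k::{comm_ring_1,topological_space} \<Rightarrow> 'v::{ab_group_add,topological_space} \<Rightarrow> 'v) \<Rightarrow>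
   ('k \<Rightarrow> 'w::{ab_group_add,topological_space} \<Rightarrow> 'w) \<Rightarrow> nat \<Rightarrow> 'v set \<Rightarrow> ('v \<Rightarrow> 'w) \<Rightarrow> bool"
where
  "Ck_on sV sW k U f \<longleftrightarrow> tower_Ck sV sW k 0 (Base ` U) (\<lambda>p. f (base p))"

definition smooth_map_on ::
  "('k::{comm_ring_1,topological_space} \<Rightarrow> 'v::{ab_group_add,topological_space} \<Rightarrow> 'v) \<Rightarrow>
   ('k \<Rightarrow> 'w::{ab_group_add,topological_space} \<Rightarrow> 'w) \<Rightarrow> 'v set \<Rightarrow> ('v \<Rightarrow> 'w) \<Rightarrow> bool"
where
  "smooth_map_on sV sW U f \<longleftrightarrow> (\<forall>k. Ck_on sV sW k U f)"

section \<open>Jordan pairs\<close>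

definition trilinear ::
  "('k::comm_ring_1 \<Rightarrow> 'v::ab_group_add \<Rightarrow> 'v) \<Rightarrow> ('k \<Rightarrow> 'w::ab_group_add \<Rightarrow> 'w) \<Rightarrow>
   ('v \<Rightarrow> 'w \<Rightarrow> 'v \<Rightarrow> 'v) \<Rightarrow> bool"
where
  "trilinear s s' T \<longleftrightarrow>
     (\<forall>y z. module_hom s s (\<lambda>x. T x y z)) \<and>
     (\<forall>x z. module_hom s' s (\<lambda>y. T x y z)) \<and>
     (\<forall>x y. module_hom s s (\<lambda>z. T x y z))"

definition jordan_identities ::
  "('v::ab_group_add \<Rightarrow> 'w::ab_group_add \<Rightarrow> 'v \<Rightarrow> 'v) \<Rightarrow> ('w \<Rightarrow> 'v \<Rightarrow> 'w \<Rightarrow> 'w) \<Rightarrow> bool"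
where
  "jordan_identities T T' \<longleftrightarrow>
     (\<forall>x y z. T x y z = T z y x) \<and>
     (\<forall>x y u v w. T x y (T u v w) = T (T x y u) v w - T u (T' y x v) w + T u v (T x y w))"

locale jordan_pair = Vp: module sp + Vm: module sm
  for sp :: "'k::comm_ring_1 \<Rightarrow> 'p::ab_group_add \<Rightarrow> 'p"
    and sm :: "'k \<Rightarrow> 'm::ab_group_add \<Rightarrow> 'm" +
  fixes Tp :: "'p \<Rightarrow> 'm \<Rightarrow> 'p \<Rightarrow> 'p"
    and Tm :: "'m \<Rightarrow> 'p \<Rightarrow> 'm \<Rightarrow> 'm"
  assumes trilinear_p: "trilinear sp sm Tp"
    and trilinear_m: "trilinear sm sp Tm"
    and jordan_p: "jordan_identities Tp Tm"
    and jordan_m: "jordan_identities Tm Tp"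

locale topological_jordan_pair =
  dense_unit_ring "TYPE('k)" + jordan_pair sp sm Tp Tm +
  Vp: topological_module sp + Vm: topological_module sm
  for sp :: "'k::{comm_ring_1,topological_ab_group_add,topological_semigroup_mult} \<Rightarrow>
      'p::{topological_ab_group_add,t2_space} \<Rightarrow> 'p"
    and sm :: "'k \<Rightarrow> 'm::{topological_ab_group_add,t2_space} \<Rightarrow> 'm"
    and Tp :: "'p \<Rightarrow> 'm \<Rightarrow> 'p \<Rightarrow> 'p"
    and Tm :: "'m \<Rightarrow> 'p \<Rightarrow> 'm \<Rightarrow> 'm" +
  assumes continuous_Tp: "continuous_on UNIV (\<lambda>(x, y, z). Tp x y z)"
    and continuous_Tm: "continuous_on UNIV (\<lambda>(x, y, z). Tm x y z)"

text \<open>In the following definitions the arguments \<open>sp sm Tp Tm\<close> yield the operators with index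
  \<open>+\<close>; those with index \<open>-\<close> are obtained by passing \<open>sm sp Tm Tp\<close> instead.\<close>

definition jordan_Q ::
  "('k::comm_ring_1 \<Rightarrow> 'v \<Rightarrow> 'v) \<Rightarrow> ('v \<Rightarrow> 'w \<Rightarrow> 'v \<Rightarrow> 'v) \<Rightarrow> 'v \<Rightarrow> 'w \<Rightarrow> 'v"
where
  "jordan_Q s T x y = s (unit_inv 2) (T x y x)"

definition bergman ::
  "('k::comm_ring_1 \<Rightarrow> 'v::ab_group_add \<Rightarrow> 'v) \<Rightarrow> ('k \<Rightarrow> 'w \<Rightarrow> 'w) \<Rightarrow>
   ('v \<Rightarrow> 'w \<Rightarrow> 'v \<Rightarrow> 'v) \<Rightarrow> ('w \<Rightarrow> 'v \<Rightarrow> 'w \<Rightarrow> 'w) \<Rightarrow> 'v \<Rightarrow> 'w \<Rightarrow> 'v \<Rightarrow> 'v"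
where
  "bergman s s' T T' x a v = v - T x a v + jordan_Q s T x (jordan_Q s' T' a v)"

definition quasi_invertible ::
  "('k::comm_ring_1 \<Rightarrow> 'v::ab_group_add \<Rightarrow> 'v) \<Rightarrow> ('k \<Rightarrow> 'w::ab_group_add \<Rightarrow> 'w) \<Rightarrow>
   ('v \<Rightarrow> 'w \<Rightarrow> 'v \<Rightarrow> 'v) \<Rightarrow> ('w \<Rightarrow> 'v \<Rightarrow> 'w \<Rightarrow> 'w) \<Rightarrow> ('v \<times> 'w) set"
where
  "quasi_invertible s s' T T' =
     {(x, a). bij (bergman s s' T T' x a) \<and> bij (bergman s' s T' T a x)}"

text \<open>The set \<open>U\<^sub>a\<close>; the set \<open>U\<^sub>x\<close> is its dual.\<close>

definition quasi_invertible_at ::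
  "('k::comm_ring_1 \<Rightarrow> 'v::ab_group_add \<Rightarrow> 'v) \<Rightarrow> ('k \<Rightarrow> 'w::ab_group_add \<Rightarrow> 'w) \<Rightarrow>
   ('v \<Rightarrow> 'w \<Rightarrow> 'v \<Rightarrow> 'v) \<Rightarrow> ('w \<Rightarrow> 'v \<Rightarrow> 'w \<Rightarrow> 'w) \<Rightarrow> 'w \<Rightarrow> 'v set"
where
  "quasi_invertible_at s s' T T' a = {x. (x, a) \<in> quasi_invertible s s' T T'}"

definition quasi_inverse ::
  "('k::comm_ring_1 \<Rightarrow> 'v::ab_group_add \<Rightarrow> 'v) \<Rightarrow> ('k \<Rightarrow> 'w \<Rightarrow> 'w) \<Rightarrow>
   ('v \<Rightarrow> 'w \<Rightarrow> 'v \<Rightarrow> 'v) \<Rightarrow> ('w \<Rightarrow> 'v \<Rightarrow> 'w \<Rightarrow> 'w) \<Rightarrow> 'v \<Rightarrow> 'w \<Rightarrow> 'v"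
where
  "quasi_inverse s s' T T' x a = inv (bergman s s' T T' x a) (x - jordan_Q s T x a)"

locale C1_jordan_pair = topological_jordan_pair +
  assumes open_quasi_invertible: "open (quasi_invertible sp sm Tp Tm)"
    and continuous_inv_bergman:
      "continuous_on {(x, a, v, b). (x, a) \<in> quasi_invertible sp sm Tp Tm}
         (\<lambda>(x, a, v, b). (inv (bergman sp sm Tp Tm x a) v, inv (bergman sm sp Tm Tp a x) b))"

locale C2_jordan_pair = topological_jordan_pair +
  assumes open_quasi_invertible_at_p: "\<And>a. open (quasi_invertible_at sp sm Tp Tm a)"
    and continuous_inv_bergman_p:
      "\<And>a. continuous_on (quasi_invertible_at sp sm Tp Tm a \<times> UNIV)
         (\<lambda>(x, v). inv (bergman sp sm Tp Tm x a) v)"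
    and open_quasi_invertible_at_m: "\<And>x. open (quasi_invertible_at sm sp Tm Tp x)"
    and continuous_inv_bergman_m:
      "\<And>x. continuous_on (quasi_invertible_at sm sp Tm Tp x \<times> UNIV)
         (\<lambda>(a, b). inv (bergman sm sp Tm Tp a x) b)"

end

theory Submission
  imports Defs
begin

text \<open>
  Only one map here is not polynomial, namely \<open>(x, a, u) \<mapsto> B(x, a)\<^sup>-\<^sup>1 u\<close>, and the
  resolvent identity reproduces it when it is differentiated. Let \<open>x\<close>, \<open>a\<close>, \<open>u\<close> depend on a point,
  let primes denote the values at a point shifted by \<open>t\<close> times a direction, and let
  \<open>x\<^sub>1\<close>, \<open>a\<^sub>1\<close>, \<open>u\<^sub>1\<close> be the difference quotients, so that \<open>x' - x = t x\<^sub>1\<close> and so on. The Bergman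
  operator is polynomial in \<open>x\<close> and \<open>a\<close>, hence \<open>B(x', a') - B(x, a) = t D\<close>
  for an operator \<open>D\<close> that is again polynomial in the data, and
  \<open>w = B(x, a)\<^sup>-\<^sup>1 u\<close> satisfies
  \<open>w' - w = t B(x', a')\<^sup>-\<^sup>1 (u\<^sub>1 - D w)\<close>.
  The difference quotient of \<open>w\<close> is therefore \<open>B\<^sup>-\<^sup>1\<close> applied to data of the same kind. If
  \<open>x\<close>, \<open>a\<close>, \<open>u\<close> are \<open>C\<^sup>k\<^sup>+\<^sup>1\<close>, then \<open>x'\<close>, \<open>a'\<close>, \<open>x\<^sub>1\<close>, \<open>a\<^sub>1\<close>, \<open>u\<^sub>1\<close> are \<open>C\<^sup>k\<close>, and so is \<open>w\<close> by induction;
  hence \<open>u\<^sub>1 - D w\<close> is \<open>C\<^sup>k\<close>, by induction again the difference quotient of \<open>w\<close> is \<open>C\<^sup>k\<close>, and \<open>w\<close> is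
  \<open>C\<^sup>k\<^sup>+\<^sup>1\<close>. The start \<open>k = 0\<close> is the continuity in (C1) or (C2). This is
  \<open>hereditary_Ck_inv_bergman\<close>; taking \<open>u = x - Q(x) a\<close> gives the quasi-inverse.

  What remains is a calculus of \<open>C\<^sup>k\<close> maps on the iterated modules \<open>V\<^sub>n\<close>: closure under sums, scalar
  multiples, continuous trilinear maps, pairing, and the two passages from \<open>V\<^sub>n\<close> to \<open>V\<^sub>n\<^sub>+\<^sub>1\<close> which send
  \<open>f(x)\<close> to the functions \<open>f(x)\<close> and \<open>f(x + t v)\<close> of \<open>(x, v, t)\<close>. The latter passage costs one degree of
  differentiability, because it is obtained as \<open>f(x) + t f\<^sup>[\<^sup>1\<^sup>](x, v, t)\<close>.

  Both halves of the theorem come from one statement about a set \<open>\<Omega>\<close> of quasi-invertible pairs on which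
  inversion is continuous: for (C1) it is the set of all such pairs, for (C2) it is the
  slice \<open>U\<^sub>a \<times> {a}\<close>.
\<close>

section \<open>Hereditarily continuous difference quotients\<close>

definition difference_quotient where
  "difference_quotient sV sW n U f g \<longleftrightarrow> (\<forall>x v t. Ext x v t \<in> ext_domain sV n U \<longrightarrow>
     f (tower_add x (tower_scale sV t v)) - f x = sW t (g (Ext x v t)))"

lemma difference_quotientD:
  assumes "difference_quotient sV sW n U f g" "Ext x v t \<in> ext_domain sV n U"
  shows "f (tower_add x (tower_scale sV t v)) - f x = sW t (g (Ext x v t))"
  using assms by (auto simp: difference_quotient_def)

text \<open>The \<open>C\<^sup>k\<close> condition with continuity of the map itself demanded at every stage. This makes the
  hierarchy decreasing in \<open>k\<close> by a trivial induction, where otherwise \<open>C\<^sup>1\<close> maps would first have to be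
  shown continuous.\<close>
primrec hereditary_Ck ::
  "('k::{comm_ring_1,topological_space} \<Rightarrow> 'v::{ab_group_add,topological_space} \<Rightarrow> 'v) \<Rightarrow>
   ('k \<Rightarrow> 'w::{ab_group_add,topological_space} \<Rightarrow> 'w) \<Rightarrow>
   nat \<Rightarrow> nat \<Rightarrow> ('v, 'k) tower set \<Rightarrow> (('v, 'k) tower \<Rightarrow> 'w) \<Rightarrow> bool"
where
  "hereditary_Ck sV sW 0 = (\<lambda>n U f. continuous_map (subtopology (tower_top n) U) euclidean f)"
| "hereditary_Ck sV sW (Suc k) = (\<lambda>n U f.
     continuous_map (subtopology (tower_top n) U) euclidean f \<and>
     (\<exists>g. difference_quotient sV sW n U f g \<and> hereditary_Ck sV sW k (Suc n) (ext_domain sV n U) g))"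

lemma hereditary_Ck_continuous:
  "hereditary_Ck sV sW k n U f \<Longrightarrow> continuous_map (subtopology (tower_top n) U) euclidean f"
  by (cases k) auto

lemma hereditary_Ck_SucI:
  assumes "continuous_map (subtopology (tower_top n) U) euclidean f"
    and "hereditary_Ck sV sW k (Suc n) (ext_domain sV n U) g"
    and "\<And>x v t. \<lbrakk>Ext x v t \<in> ext_domain sV n U; x \<in> U; v \<in> topspace (tower_top n);
            tower_add x (tower_scale sV t v) \<in> U\<rbrakk> \<Longrightarrow>
          f (tower_add x (tower_scale sV t v)) - f x = sW t (g (Ext x v t))"
  shows "hereditary_Ck sV sW (Suc k) n U f"
proof -
  have "difference_quotient sV sW n U f g"
    unfolding difference_quotient_def by (auto simp: ext_domain_def intro!: assms(3))
  with assms(1,2) show ?thesis by auto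
qed

lemma hereditary_Ck_SucE:
  assumes "hereditary_Ck sV sW (Suc k) n U f"
  obtains g where "hereditary_Ck sV sW k (Suc n) (ext_domain sV n U) g"
    and "difference_quotient sV sW n U f g"
  using assms by auto

lemma hereditary_Ck_imp_tower_Ck: "hereditary_Ck sV sW k n U f \<Longrightarrow> tower_Ck sV sW k n U f"
proof (induction k arbitrary: n U f)
  case (Suc k)
  obtain g where g: "hereditary_Ck sV sW k (Suc n) (ext_domain sV n U) g"
    and d: "difference_quotient sV sW n U f g"
    by (rule hereditary_Ck_SucE[OF Suc.prems])
  show ?case
    unfolding tower_Ck.simps
    by (intro exI[of _ g] conjI allI impI hereditary_Ck_continuous[OF g] difference_quotientD[OF d]
        Suc.IH[OF g])
qed simp

lemma hereditary_Ck_SucD: "hereditary_Ck sV sW (Suc k) n U f \<Longrightarrow> hereditary_Ck sV sW k n U f"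
proof (induction k arbitrary: n U f)
  case 0
  then show ?case using hereditary_Ck_continuous by simp
next
  case (Suc k)
  obtain g where g: "hereditary_Ck sV sW (Suc k) (Suc n) (ext_domain sV n U) g"
    and d: "difference_quotient sV sW n U f g"
    by (rule hereditary_Ck_SucE[OF Suc.prems])
  show ?case
    by (rule hereditary_Ck_SucI[OF hereditary_Ck_continuous[OF Suc.prems] Suc.IH[OF g]])
      (rule difference_quotientD[OF d])
qed

lemma continuous_map_eq_on:
  assumes "continuous_map (subtopology X U) Y f" "\<And>p. p \<in> U \<Longrightarrow> f p = f' p"
  shows "continuous_map (subtopology X U) Y f'"
  by (rule continuous_map_eq[OF assms(1)]) (simp add: assms(2))

text \<open>Both the difference equation and continuity see a map only on its domain.\<close>
lemma hereditary_Ck_cong: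
  assumes f: "hereditary_Ck sV sW k n U f" and eq: "\<And>p. p \<in> U \<Longrightarrow> f p = f' p"
  shows "hereditary_Ck sV sW k n U f'"
proof (cases k)
  case 0
  then show ?thesis using continuous_map_eq_on[of "tower_top n" U euclidean f f'] f eq by simp
next
  case (Suc j)
  obtain g where g: "hereditary_Ck sV sW j (Suc n) (ext_domain sV n U) g"
    and d: "difference_quotient sV sW n U f g"
    by (rule hereditary_Ck_SucE[OF f[unfolded Suc]])
  show ?thesis
    unfolding Suc
  proof (rule hereditary_Ck_SucI[OF _ g])
    show "continuous_map (subtopology (tower_top n) U) euclidean f'"
      by (rule continuous_map_eq_on[OF hereditary_Ck_continuous[OF f] eq])
  next
    fix x v t
    assume "Ext x v t \<in> ext_domain sV n U" "x \<in> U" "tower_add x (tower_scale sV t v) \<in> U"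
    then show "f' (tower_add x (tower_scale sV t v)) - f' x = sW t (g (Ext x v t))"
      using difference_quotientD[OF d, of x v t] eq by simp
  qed
qed

section \<open>Linear maps on the iterated modules\<close>

declare tower_top.simps [simp del]

lemma topspace_tower_0 [simp]: "topspace (tower_top 0) = range Base"
  by (auto simp: topspace_pullback_topology tower_top.simps)

lemma topspace_tower_Suc [simp]:
  "topspace (tower_top (Suc n)) =
     {Ext x v t | x v t. x \<in> topspace (tower_top n) \<and> v \<in> topspace (tower_top n)}"
  by (auto simp: topspace_pullback_topology tower_top.simps)

lemma ext_domain_subset_topspace:
  "U \<subseteq> topspace (tower_top n) \<Longrightarrow> ext_domain sV n U \<subseteq> topspace (tower_top (Suc n))"
  by (auto simp: ext_domain_def)

lemma continuous_map_base: "continuous_map (tower_top 0) euclidean base"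
  using continuous_map_pullback[OF continuous_map_id, of "range Base" base euclidean]
  by (simp add: tower_top.simps)

lemma continuous_map_tower_coordinates:
  "continuous_map (tower_top (Suc n)) (prod_topology (tower_top n) (prod_topology (tower_top n) euclidean))
     (\<lambda>p. (point p, direction p, param p))"
  unfolding tower_top.simps by (rule continuous_map_pullback[OF continuous_map_id, unfolded id_comp])

lemma continuous_map_point: "continuous_map (tower_top (Suc n)) (tower_top n) point"
  and continuous_map_direction: "continuous_map (tower_top (Suc n)) (tower_top n) direction"
  and continuous_map_param: "continuous_map (tower_top (Suc n)) euclidean param"
  using continuous_map_tower_coordinates[of n] by (auto simp: continuous_map_paired)

text \<open>The map \<open>(x, v, t) \<mapsto> (l x, l v, t)\<close>: for linear \<open>l\<close>, the chain rule reads
  \<open>(f \<circ> l)\<^sup>[\<^sup>1\<^sup>] = f\<^sup>[\<^sup>1\<^sup>] \<circ> ext_map l\<close>.\<close>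
definition ext_map :: "(('v, 'k) tower \<Rightarrow> ('v, 'k) tower) \<Rightarrow> ('v, 'k) tower \<Rightarrow> ('v, 'k) tower" where
  "ext_map l p = Ext (l (point p)) (l (direction p)) (param p)"

lemma continuous_map_ext_map:
  assumes "continuous_map (tower_top n) (tower_top m) l"
  shows "continuous_map (tower_top (Suc n)) (tower_top (Suc m)) (ext_map l)"
proof -
  have "continuous_map (tower_top (Suc n)) (prod_topology (tower_top m) (prod_topology (tower_top m) euclidean))
     (\<lambda>p. (l (point p), l (direction p), param p))"
    using continuous_map_compose[OF continuous_map_point assms]
      continuous_map_compose[OF continuous_map_direction assms] continuous_map_param
    by (simp add: continuous_map_paired o_def)
  then show ?thesis
    unfolding tower_top.simps(2)[of m]
    by (intro continuous_map_pullback') (auto simp: o_def ext_map_def)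
qed

lemma continuous_map_restrict:
  "\<lbrakk>continuous_map X Y l; l ` U \<subseteq> U'\<rbrakk> \<Longrightarrow> continuous_map (subtopology X U) (subtopology Y U') l"
  by (auto simp: continuous_map_in_subtopology continuous_map_from_subtopology)

text \<open>Linear substitution is closed under the chain rule because \<open>ext_map l\<close> is again linear. The case
  of interest is \<open>l = point\<close>, but its induction passes through \<open>ext_map point\<close> and the further
  iterates, so that general \<open>l\<close> is the right setting.\<close>
lemma hereditary_Ck_compose_linear:
  assumes "hereditary_Ck sV sW k m U' f"
    and "continuous_map (tower_top n) (tower_top m) l"
    and "\<And>x v t. \<lbrakk>x \<in> topspace (tower_top n); v \<in> topspace (tower_top n)\<rbrakk> \<Longrightarrow>
           l (tower_add x (tower_scale sV t v)) = tower_add (l x) (tower_scale sV t (l v))"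
    and "U \<subseteq> topspace (tower_top n)" and "l ` U \<subseteq> U'"
  shows "hereditary_Ck sV sW k n U (\<lambda>p. f (l p))"
  using assms
proof (induction k arbitrary: n m U U' f l)
  case 0
  then have "continuous_map (subtopology (tower_top n) U) (subtopology (tower_top m) U') l"
    by (intro continuous_map_restrict)
  from continuous_map_compose[OF this] 0 show ?case by (simp add: o_def)
next
  case (Suc k)
  note linear = Suc.prems(3)
  have c: "continuous_map (subtopology (tower_top n) U) (subtopology (tower_top m) U') l"
    using Suc.prems by (intro continuous_map_restrict)
  have into: "l v \<in> topspace (tower_top m)" if "v \<in> topspace (tower_top n)" for v
    using continuous_map_funspace[OF Suc.prems(2)] that by auto
  obtain g where g: "hereditary_Ck sV sW k (Suc m) (ext_domain sV m U') g"
    and d: "difference_quotient sV sW m U' f g"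
    by (rule hereditary_Ck_SucE[OF Suc.prems(1)])
  have ext: "ext_map l ` ext_domain sV n U \<subseteq> ext_domain sV m U'"
  proof -
    have "Ext (l x) (l v) t \<in> ext_domain sV m U'"
      if "x \<in> U" "v \<in> topspace (tower_top n)" "tower_add x (tower_scale sV t v) \<in> U" for x v t
    proof -
      have "l (tower_add x (tower_scale sV t v)) \<in> U'" "l x \<in> U'"
        using that Suc.prems(5) by auto
      then show ?thesis
        using that Suc.prems(4) linear[of x v t] into by (auto simp: ext_domain_def)
    qed
    then show ?thesis by (auto simp: ext_domain_def[of sV n] ext_map_def)
  qed
  have "hereditary_Ck sV sW k (Suc n) (ext_domain sV n U) (\<lambda>p. g (ext_map l p))"
    by (rule Suc.IH[OF g continuous_map_ext_map[OF Suc.prems(2)] _ ext_domain_subset_topspace[OF Suc.prems(4)] ext])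
      (auto simp: ext_map_def linear)
  then show ?case
  proof (rule hereditary_Ck_SucI[rotated])
    show "continuous_map (subtopology (tower_top n) U) euclidean (\<lambda>p. f (l p))"
      using continuous_map_compose[OF c hereditary_Ck_continuous[OF Suc.prems(1)]] by (simp add: o_def)
  next
    fix x v t
    assume *: "Ext x v t \<in> ext_domain sV n U" "x \<in> U" "v \<in> topspace (tower_top n)"
    then have "ext_map l (Ext x v t) \<in> ext_domain sV m U'"
      using ext by blast
    then have "Ext (l x) (l v) t \<in> ext_domain sV m U'"
      by (simp add: ext_map_def)
    from difference_quotientD[OF d this]
    show "f (l (tower_add x (tower_scale sV t v))) - f (l x) = sW t (g (ext_map l (Ext x v t)))"
      using linear[of x v t] * Suc.prems(4) by (auto simp: ext_map_def)
  qed
qed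

lemma hereditary_Ck_point:
  assumes "hereditary_Ck sV sW k n U f" "U \<subseteq> topspace (tower_top n)"
  shows "hereditary_Ck sV sW k (Suc n) (ext_domain sV n U) (\<lambda>p. f (point p))"
  by (rule hereditary_Ck_compose_linear[OF assms(1) continuous_map_point _ ext_domain_subset_topspace[OF assms(2)]])
    (auto simp: ext_domain_def)

text \<open>The difference quotient of a linear \<open>f\<close> is \<open>(x, v, t) \<mapsto> f v\<close>, which is linear as well.\<close>
lemma hereditary_Ck_linear:
  assumes "continuous_map (tower_top n) euclidean f"
    and "\<And>x v t. \<lbrakk>x \<in> topspace (tower_top n); v \<in> topspace (tower_top n)\<rbrakk> \<Longrightarrow>
           f (tower_add x (tower_scale sV t v)) = f x + sW t (f v)"
    and "U \<subseteq> topspace (tower_top n)"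
  shows "hereditary_Ck sV sW k n U f"
  using assms
proof (induction k arbitrary: n U f)
  case 0
  then show ?case by (simp add: continuous_map_from_subtopology)
next
  case (Suc k)
  have "hereditary_Ck sV sW k (Suc n) (ext_domain sV n U) (\<lambda>p. f (direction p))"
  proof (rule Suc.IH)
    show "continuous_map (tower_top (Suc n)) euclidean (\<lambda>p. f (direction p))"
      using continuous_map_compose[OF continuous_map_direction Suc.prems(1)] by (simp add: o_def)
    show "ext_domain sV n U \<subseteq> topspace (tower_top (Suc n))"
      by (rule ext_domain_subset_topspace[OF Suc.prems(3)])
  qed (auto simp: Suc.prems(2))
  then show ?case
    by (rule hereditary_Ck_SucI[rotated])
      (use Suc.prems in \<open>auto simp: continuous_map_from_subtopology\<close>)
qed

lemma hereditary_Ck_param: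
  assumes "U \<subseteq> topspace (tower_top n)"
  shows "hereditary_Ck sV (*) k (Suc n) (ext_domain sV n U) param"
  by (rule hereditary_Ck_linear[OF continuous_map_param _ ext_domain_subset_topspace[OF assms]]) auto

section \<open>Calculus of maps into topological modules\<close>

lemma continuous_map_Pair_euclidean:
  assumes "continuous_map X euclidean f" "continuous_map X euclidean g"
  shows "continuous_map X euclidean (\<lambda>p. (f p, g p))"
  using assms by (simp add: continuous_map_paired flip: prod_topology_euclidean)

lemma continuous_map_compose_continuous_on:
  assumes "continuous_map (subtopology X U) euclidean f" "continuous_on S h" "\<And>p. p \<in> U \<Longrightarrow> f p \<in> S"
  shows "continuous_map (subtopology X U) euclidean (\<lambda>p. h (f p))"
proof -
  have "continuous_map (subtopology X U) (top_of_set S) f"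
    using assms by (auto intro!: continuous_map_into_subtopology)
  from continuous_map_compose[OF this, of euclidean h] show ?thesis
    using assms(2) by (simp add: o_def)
qed

definition shift where
  "shift sV q = tower_add (point q) (tower_scale sV (param q) (direction q))"

text \<open>Topological modules without the Hausdorff condition, so as to include the base ring: scalar
  functions such as the parameter \<open>t\<close> are module-valued maps in the calculus below.\<close>
locale continuous_module = module scale
  for scale :: "'k::{comm_ring_1,topological_ab_group_add,topological_semigroup_mult} \<Rightarrow>
      'w::topological_ab_group_add \<Rightarrow> 'w" +
  assumes continuous_scale: "continuous_on UNIV (\<lambda>(t, w). scale t w)"

sublocale topological_module \<subseteq> continuous_module
  by unfold_locales (rule continuous_scale)

lemma continuous_module_mult:
  "continuous_module ((*) :: 'k \<Rightarrow> 'k \<Rightarrow> 'k::{comm_ring_1,topological_ab_group_add,topological_semigroup_mult})"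
  by unfold_locales (auto simp: algebra_simps case_prod_unfold intro!: continuous_intros)

context continuous_module
begin

lemma hereditary_Ck_const: "hereditary_Ck sV scale k n U (\<lambda>_. c)"
proof (induction k arbitrary: n U c)
  case (Suc k)
  show ?case by (rule hereditary_Ck_SucI[OF _ Suc.IH[where c=0]]) auto
qed simp

lemma hereditary_Ck_add:
  assumes "hereditary_Ck sV scale k n U f" "hereditary_Ck sV scale k n U g"
  shows "hereditary_Ck sV scale k n U (\<lambda>p. f p + g p)"
  using assms
proof (induction k arbitrary: n U f g)
  case 0
  have "continuous_on UNIV (\<lambda>q::'w\<times>'w. fst q + snd q)"
    by (intro continuous_intros)
  from continuous_map_compose_continuous_on[OF continuous_map_Pair_euclidean this] 0
  show ?case by auto
next
  case (Suc k)
  have "continuous_on UNIV (\<lambda>q::'w\<times>'w. fst q + snd q)"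
    by (intro continuous_intros)
  from continuous_map_compose_continuous_on[OF continuous_map_Pair_euclidean this]
  have c: "continuous_map (subtopology (tower_top n) U) euclidean (\<lambda>p. f p + g p)"
    using Suc.prems[THEN hereditary_Ck_continuous] by auto
  obtain f1 where f1: "hereditary_Ck sV scale k (Suc n) (ext_domain sV n U) f1"
      "difference_quotient sV scale n U f f1"
    by (rule hereditary_Ck_SucE[OF Suc.prems(1)])
  obtain g1 where g1: "hereditary_Ck sV scale k (Suc n) (ext_domain sV n U) g1"
      "difference_quotient sV scale n U g g1"
    by (rule hereditary_Ck_SucE[OF Suc.prems(2)])
  show ?case
    by (rule hereditary_Ck_SucI[OF c Suc.IH[OF f1(1) g1(1)]])
      (simp add: scale_right_distrib flip: f1(2)[THEN difference_quotientD] g1(2)[THEN difference_quotientD])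
qed

text \<open>The product rule is expanded around the unshifted point,
  \<open>a' f' - a f = t (a\<^sub>1 f + a f\<^sub>1 + t a\<^sub>1 f\<^sub>1)\<close>, since differentiability at the shifted point
  (\<open>hereditary_Ck_shift\<close>) itself rests on this lemma. The last term is again a product of scalars
  and vectors, \<open>a\<^sub>1 (t f\<^sub>1)\<close>, covered by two uses of the induction hypothesis.\<close>
lemma hereditary_Ck_scale:
  assumes "hereditary_Ck sV (*) k n U a" "hereditary_Ck sV scale k n U f" "U \<subseteq> topspace (tower_top n)"
  shows "hereditary_Ck sV scale k n U (\<lambda>p. scale (a p) (f p))"
  using assms
proof (induction k arbitrary: n U a f)
  case 0
  from continuous_map_compose_continuous_on[OF continuous_map_Pair_euclidean continuous_scale] 0
  show ?case by auto
next
  case (Suc k)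
  from continuous_map_compose_continuous_on[OF continuous_map_Pair_euclidean continuous_scale]
  have c: "continuous_map (subtopology (tower_top n) U) euclidean (\<lambda>p. scale (a p) (f p))"
    using Suc.prems(1,2)[THEN hereditary_Ck_continuous] by auto
  obtain a1 where a1: "hereditary_Ck sV (*) k (Suc n) (ext_domain sV n U) a1"
      "difference_quotient sV (*) n U a a1"
    by (rule hereditary_Ck_SucE[OF Suc.prems(1)])
  obtain f1 where f1: "hereditary_Ck sV scale k (Suc n) (ext_domain sV n U) f1"
      "difference_quotient sV scale n U f f1"
    by (rule hereditary_Ck_SucE[OF Suc.prems(2)])
  note dom = ext_domain_subset_topspace[OF Suc.prems(3)]
  note a0 = hereditary_Ck_point[OF hereditary_Ck_SucD[OF Suc.prems(1)] Suc.prems(3)]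
  note f0 = hereditary_Ck_point[OF hereditary_Ck_SucD[OF Suc.prems(2)] Suc.prems(3)]
  note t = hereditary_Ck_param[OF Suc.prems(3)]
  have "hereditary_Ck sV scale k (Suc n) (ext_domain sV n U)
     (\<lambda>q. scale (a1 q) (f (point q)) + scale (a (point q)) (f1 q) + scale (a1 q) (scale (param q) (f1 q)))"
    by (intro hereditary_Ck_add Suc.IH a0 f0 a1(1) f1(1) t dom)
  then show ?case
  proof (rule hereditary_Ck_SucI[OF c])
    fix x v t
    assume q: "Ext x v t \<in> ext_domain sV n U"
    let ?q = "Ext x v t" and ?y = "tower_add x (tower_scale sV t v)"
    have "a ?y = a x + t * a1 ?q" "f ?y = f x + scale t (f1 ?q)"
      using difference_quotientD[OF a1(2) q] difference_quotientD[OF f1(2) q] by (simp_all add: algebra_simps)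
    then show "scale (a ?y) (f ?y) - scale (a x) (f x) =
      scale t (scale (a1 ?q) (f (point ?q)) + scale (a (point ?q)) (f1 ?q) +
        scale (a1 ?q) (scale (param ?q) (f1 ?q)))"
      by (simp add: scale_left_distrib scale_right_distrib distrib_left mult_ac)
  qed
qed

lemma hereditary_Ck_scale_const:
  assumes "hereditary_Ck sV scale k n U f" "U \<subseteq> topspace (tower_top n)"
  shows "hereditary_Ck sV scale k n U (\<lambda>p. scale c (f p))"
  by (rule hereditary_Ck_scale[OF continuous_module.hereditary_Ck_const[OF continuous_module_mult] assms])

lemma hereditary_Ck_diff:
  assumes "hereditary_Ck sV scale k n U f" "hereditary_Ck sV scale k n U g" "U \<subseteq> topspace (tower_top n)"
  shows "hereditary_Ck sV scale k n U (\<lambda>p. f p - g p)"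
  using hereditary_Ck_add[OF assms(1) hereditary_Ck_scale_const[OF assms(2,3), of "- 1"]] by simp

text \<open>On the extended domain, \<open>f(x + t v) = f(x) + t f\<^sup>[\<^sup>1\<^sup>](x, v, t)\<close>; this avoids the nonlinear substitution
  \<open>(x, v, t) \<mapsto> x + t v\<close>.\<close>
lemma hereditary_Ck_shift:
  assumes f: "hereditary_Ck sV scale (Suc k) n U f" and U: "U \<subseteq> topspace (tower_top n)"
  shows "hereditary_Ck sV scale k (Suc n) (ext_domain sV n U) (\<lambda>q. f (shift sV q))"
proof -
  obtain f1 where f1: "hereditary_Ck sV scale k (Suc n) (ext_domain sV n U) f1"
      "difference_quotient sV scale n U f f1"
    by (rule hereditary_Ck_SucE[OF f])
  have "hereditary_Ck sV scale k (Suc n) (ext_domain sV n U) (\<lambda>q. f (point q) + scale (param q) (f1 q))"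
    using hereditary_Ck_point[OF hereditary_Ck_SucD[OF f] U] hereditary_Ck_param[OF U] f1(1)
      ext_domain_subset_topspace[OF U]
    by (intro hereditary_Ck_add hereditary_Ck_scale)
  then show ?thesis
  proof (rule hereditary_Ck_cong)
    fix q
    assume "q \<in> ext_domain sV n U"
    with f1(2)[THEN difference_quotientD] show "f (point q) + scale (param q) (f1 q) = f (shift sV q)"
      by (cases q) (auto simp: shift_def ext_domain_def algebra_simps)
  qed
qed

end

lemma hereditary_Ck_Pair:
  assumes "hereditary_Ck sV s k n U f" "hereditary_Ck sV s' k n U g" and m: "module_prod s s'"
  shows "hereditary_Ck sV (module_prod.scale s s') k n U (\<lambda>p. (f p, g p))"
  using assms(1,2)
proof (induction k arbitrary: n U f g)
  case 0
  then show ?case by (simp add: continuous_map_Pair_euclidean)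
next
  case (Suc k)
  obtain f1 where f1: "hereditary_Ck sV s k (Suc n) (ext_domain sV n U) f1"
      "difference_quotient sV s n U f f1"
    by (rule hereditary_Ck_SucE[OF Suc.prems(1)])
  obtain g1 where g1: "hereditary_Ck sV s' k (Suc n) (ext_domain sV n U) g1"
      "difference_quotient sV s' n U g g1"
    by (rule hereditary_Ck_SucE[OF Suc.prems(2)])
  show ?case
  proof (rule hereditary_Ck_SucI[OF _ Suc.IH[OF f1(1) g1(1)]])
    show "continuous_map (subtopology (tower_top n) U) euclidean (\<lambda>p. (f p, g p))"
      using Suc.prems[THEN hereditary_Ck_continuous] by (intro continuous_map_Pair_euclidean)
  qed (simp add: module_prod.scale_def[OF m] f1(2)[THEN difference_quotientD] g1(2)[THEN difference_quotientD])
qed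

section \<open>Trilinear maps\<close>

lemma trilinear_difference:
  assumes "trilinear s s' T" "x' - x = s t x1" "y' - y = s' t y1" "z' - z = s t z1"
  shows "T x' y' z' - T x y z = s t (T x1 y' z' + T x y1 z' + T x y z1)"
proof -
  have h: "module_hom s s (\<lambda>x. T x y z)" "module_hom s' s (\<lambda>y. T x y z)"
    "module_hom s s (\<lambda>z. T x y z)" for x y z
    using assms(1) by (auto simp: trilinear_def)
  interpret s: module s using h(1) by (rule module_hom.axioms)
  have "T x' y' z' - T x y z = T (x' - x) y' z' + T x (y' - y) z' + T x y (z' - z)"
    by (simp add: module_hom.diff[OF h(1)] module_hom.diff[OF h(2)] module_hom.diff[OF h(3)])
  also have "\<dots> = s t (T x1 y' z') + s t (T x y1 z') + s t (T x y z1)"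
    by (simp only: assms(2-4) module_hom.scale[OF h(1)] module_hom.scale[OF h(2)] module_hom.scale[OF h(3)])
  finally show ?thesis by (simp add: s.scale_right_distrib)
qed

text \<open>The Leibniz rule in the telescoping form of \<open>trilinear_difference\<close> is linear in each difference
  quotient, and involves the maps at the shifted and at the unshifted point.\<close>
lemma hereditary_Ck_trilinear:
  assumes s: "continuous_module s" and s': "continuous_module s'"
    and T: "trilinear s s' T" and cont: "continuous_on UNIV (\<lambda>(x, y, z). T x y z)"
    and "hereditary_Ck sV s k n U f" "hereditary_Ck sV s' k n U g" "hereditary_Ck sV s k n U h"
    and "U \<subseteq> topspace (tower_top n)"
  shows "hereditary_Ck sV s k n U (\<lambda>p. T (f p) (g p) (h p))"
  using assms(5-)
proof (induction k arbitrary: n U f g h)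
  case 0
  from continuous_map_compose_continuous_on[OF continuous_map_Pair_euclidean[OF _ continuous_map_Pair_euclidean] cont] 0
  show ?case by auto
next
  case (Suc k)
  interpret s: continuous_module s by fact
  interpret s': continuous_module s' by fact
  from continuous_map_compose_continuous_on[OF continuous_map_Pair_euclidean[OF _ continuous_map_Pair_euclidean] cont]
  have c: "continuous_map (subtopology (tower_top n) U) euclidean (\<lambda>p. T (f p) (g p) (h p))"
    using Suc.prems(1-3)[THEN hereditary_Ck_continuous] by auto
  obtain f1 where f1: "hereditary_Ck sV s k (Suc n) (ext_domain sV n U) f1"
      "difference_quotient sV s n U f f1"
    by (rule hereditary_Ck_SucE[OF Suc.prems(1)])
  obtain g1 where g1: "hereditary_Ck sV s' k (Suc n) (ext_domain sV n U) g1"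
      "difference_quotient sV s' n U g g1"
    by (rule hereditary_Ck_SucE[OF Suc.prems(2)])
  obtain h1 where h1: "hereditary_Ck sV s k (Suc n) (ext_domain sV n U) h1"
      "difference_quotient sV s n U h h1"
    by (rule hereditary_Ck_SucE[OF Suc.prems(3)])
  note U = Suc.prems(4)
  have "hereditary_Ck sV s k (Suc n) (ext_domain sV n U)
     (\<lambda>q. T (f1 q) (g (shift sV q)) (h (shift sV q)) + T (f (point q)) (g1 q) (h (shift sV q))
        + T (f (point q)) (g (point q)) (h1 q))"
    by (intro s.hereditary_Ck_add Suc.IH f1(1) g1(1) h1(1) ext_domain_subset_topspace[OF U]
        s.hereditary_Ck_shift[OF Suc.prems(3) U] s'.hereditary_Ck_shift[OF Suc.prems(2) U]
        hereditary_Ck_point[OF hereditary_Ck_SucD U] Suc.prems(1,2))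
  then show ?case
  proof (rule hereditary_Ck_SucI[OF c])
    fix x v t
    assume q: "Ext x v t \<in> ext_domain sV n U"
    let ?q = "Ext x v t" and ?y = "tower_add x (tower_scale sV t v)"
    show "T (f ?y) (g ?y) (h ?y) - T (f x) (g x) (h x) =
      s t (T (f1 ?q) (g (shift sV ?q)) (h (shift sV ?q))
        + T (f (point ?q)) (g1 ?q) (h (shift sV ?q)) + T (f (point ?q)) (g (point ?q)) (h1 ?q))"
      using trilinear_difference[OF T difference_quotientD[OF f1(2) q] difference_quotientD[OF g1(2) q]
          difference_quotientD[OF h1(2) q]]
      by (simp add: shift_def)
  qed
qed

section \<open>Inverses of Bergman operators\<close>

context topological_jordan_pair
begin

lemmas modules = Vp.continuous_module_axioms Vm.continuous_module_axioms

lemmas hereditary_Ck_Tp = hereditary_Ck_trilinear[OF modules trilinear_p continuous_Tp]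
lemmas hereditary_Ck_Tm = hereditary_Ck_trilinear[OF modules(2,1) trilinear_m continuous_Tm]

lemma hereditary_Ck_Qp:
  assumes "hereditary_Ck sV sp k n U f" "hereditary_Ck sV sm k n U g" "U \<subseteq> topspace (tower_top n)"
  shows "hereditary_Ck sV sp k n U (\<lambda>p. jordan_Q sp Tp (f p) (g p))"
  unfolding jordan_Q_def by (intro Vp.hereditary_Ck_scale_const hereditary_Ck_Tp assms)

lemma hereditary_Ck_Qm:
  assumes "hereditary_Ck sV sm k n U f" "hereditary_Ck sV sp k n U g" "U \<subseteq> topspace (tower_top n)"
  shows "hereditary_Ck sV sm k n U (\<lambda>p. jordan_Q sm Tm (f p) (g p))"
  unfolding jordan_Q_def by (intro Vm.hereditary_Ck_scale_const hereditary_Ck_Tm assms)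

text \<open>The operator \<open>D\<close> with \<open>B(x', a') - B(x, a) = t D\<close> for \<open>x' = x + t h\<close> and \<open>a' = a + t b\<close>. It is
  written with both \<open>x\<close>, \<open>a\<close> and \<open>x'\<close>, \<open>a'\<close> so that \<open>t\<close> does not occur; its terms come
  from telescoping \<open>Q(x) Q(a) v\<close> and \<open>T(x, a, v)\<close>.\<close>
definition bergman_slope :: "'p \<Rightarrow> 'm \<Rightarrow> 'p \<Rightarrow> 'm \<Rightarrow> 'p \<Rightarrow> 'm \<Rightarrow> 'p \<Rightarrow> 'p" where
  "bergman_slope x a x' a' h b v =
     sp (unit_inv 2) (Tp h (jordan_Q sm Tm a' v) x' +
       Tp x (sm (unit_inv 2) (Tm b v a' + Tm a v b)) x' + Tp x (jordan_Q sm Tm a v) h)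
     - (Tp h a' v + Tp x b v)"

lemma bergman_difference:
  assumes x: "x' - x = sp t h" and a: "a' - a = sm t b"
  shows "bergman sp sm Tp Tm x' a' v - bergman sp sm Tp Tm x a v =
    sp t (bergman_slope x a x' a' h b v)"
proof -
  have hom: "module_hom sp sp (Tp x a)" "module_hom sp sm (\<lambda>v. Tm a v a')" for x a a'
    using trilinear_p trilinear_m by (auto simp: trilinear_def)
  \<comment> \<open>The argument that stays fixed enters the telescoping with difference quotient 0.\<close>
  have "v - v = sp t 0" by simp
  note T = trilinear_difference[OF trilinear_p x a this]
  have "Tm a' v a' - Tm a v a = sm t (Tm b v a' + Tm a v b)"
    using trilinear_difference[OF trilinear_m a \<open>v - v = sp t 0\<close> a]
    by (simp add: module_hom.zero[OF hom(2)])
  then have "jordan_Q sm Tm a' v - jordan_Q sm Tm a v = sm t (sm (unit_inv 2) (Tm b v a' + Tm a v b))"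
    by (simp add: jordan_Q_def mult.commute flip: Vm.scale_right_diff_distrib)
  from trilinear_difference[OF trilinear_p x this x]
  have Q: "jordan_Q sp Tp x' (jordan_Q sm Tm a' v) - jordan_Q sp Tp x (jordan_Q sm Tm a v) =
     sp t (sp (unit_inv 2) (Tp h (jordan_Q sm Tm a' v) x' +
       Tp x (sm (unit_inv 2) (Tm b v a' + Tm a v b)) x' + Tp x (jordan_Q sm Tm a v) h))"
    by (simp add: jordan_Q_def[of sp] mult.commute flip: Vp.scale_right_diff_distrib)
  have "bergman sp sm Tp Tm x' a' v - bergman sp sm Tp Tm x a v =
     (jordan_Q sp Tp x' (jordan_Q sm Tm a' v) - jordan_Q sp Tp x (jordan_Q sm Tm a v))
     - (Tp x' a' v - Tp x a v)"
    by (simp add: bergman_def)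
  also have "\<dots> = sp t (bergman_slope x a x' a' h b v)"
    by (simp add: Q T module_hom.zero[OF hom(1)] bergman_slope_def Vp.scale_right_diff_distrib)
  finally show ?thesis .
qed

lemma module_hom_bergman: "module_hom sp sp (bergman sp sm Tp Tm x a)"
proof -
  have hom: "module_hom sp sp (Tp x a)" "module_hom sp sm (\<lambda>v. Tm a v a)" "module_hom sm sp (\<lambda>y. Tp x y x)"
    using trilinear_p trilinear_m by (auto simp: trilinear_def)
  note [simp] = hom[THEN module_hom.add] hom[THEN module_hom.scale]
  show ?thesis
    by unfold_locales
      (simp_all add: bergman_def jordan_Q_def Vp.scale_right_distrib Vp.scale_right_diff_distrib
        Vm.scale_right_distrib mult_ac)
qed

text \<open>The resolvent argument. The induction varies all three maps \<open>f\<close>, \<open>g\<close>, \<open>u\<close> together with the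
  level \<open>n\<close> because the difference quotient is the same expression formed with the shifted \<open>f\<close>, \<open>g\<close>
  and a new \<open>u\<close> on the next level. The pair \<open>(f, g)\<close> stays in \<open>\<Omega>\<close> since a point
  of the extended domain has both ends of its segment in \<open>U\<close>.\<close>
lemma hereditary_Ck_inv_bergman:
  assumes bij: "\<And>x a. (x, a) \<in> \<Omega> \<Longrightarrow> bij (bergman sp sm Tp Tm x a)"
    and cont: "continuous_on (\<Omega> \<times> UNIV) (\<lambda>((x, a), v). inv (bergman sp sm Tp Tm x a) v)"
    and "hereditary_Ck sV sp k n U f" "hereditary_Ck sV sm k n U g" "hereditary_Ck sV sp k n U u"
    and "\<And>p. p \<in> U \<Longrightarrow> (f p, g p) \<in> \<Omega>" and "U \<subseteq> topspace (tower_top n)"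
  shows "hereditary_Ck sV sp k n U (\<lambda>p. inv (bergman sp sm Tp Tm (f p) (g p)) (u p))"
  using assms(3-)
proof (induction k arbitrary: n U f g u)
  case 0
  then have "continuous_map (subtopology (tower_top n) U) euclidean (\<lambda>p. ((f p, g p), u p))"
    by (simp add: continuous_map_Pair_euclidean)
  from continuous_map_compose_continuous_on[OF this cont] 0 show ?case by auto
next
  case (Suc k)
  let ?B = "bergman sp sm Tp Tm"
  let ?w = "\<lambda>p. inv (?B (f p) (g p)) (u p)"
  have "continuous_map (subtopology (tower_top n) U) euclidean (\<lambda>p. ((f p, g p), u p))"
    using Suc.prems(1-3)[THEN hereditary_Ck_continuous] by (simp add: continuous_map_Pair_euclidean)
  from continuous_map_compose_continuous_on[OF this cont]
  have c: "continuous_map (subtopology (tower_top n) U) euclidean ?w"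
    using Suc.prems(4) by auto
  obtain f1 where f1: "hereditary_Ck sV sp k (Suc n) (ext_domain sV n U) f1"
      "difference_quotient sV sp n U f f1"
    by (rule hereditary_Ck_SucE[OF Suc.prems(1)])
  obtain g1 where g1: "hereditary_Ck sV sm k (Suc n) (ext_domain sV n U) g1"
      "difference_quotient sV sm n U g g1"
    by (rule hereditary_Ck_SucE[OF Suc.prems(2)])
  obtain u1 where u1: "hereditary_Ck sV sp k (Suc n) (ext_domain sV n U) u1"
      "difference_quotient sV sp n U u u1"
    by (rule hereditary_Ck_SucE[OF Suc.prems(3)])
  note U = Suc.prems(5)
  note dom = ext_domain_subset_topspace[OF U]
  note point = Suc.prems(1-3)[THEN hereditary_Ck_SucD, THEN hereditary_Ck_point[OF _ U]]
  note shift = Vp.hereditary_Ck_shift[OF Suc.prems(1) U] Vm.hereditary_Ck_shift[OF Suc.prems(2) U]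
  have w: "hereditary_Ck sV sp k n U ?w"
    by (rule Suc.IH[OF Suc.prems(1-3)[THEN hereditary_Ck_SucD] Suc.prems(4,5)])
  \<comment> \<open>This is \<open>u\<^sub>1 - D w\<close>; the operator \<open>D\<close> acts on \<open>w\<close> at the unshifted point.\<close>
  define r where "r q = u1 q - bergman_slope (f (point q)) (g (point q)) (f (shift sV q)) (g (shift sV q))
      (f1 q) (g1 q) (?w (point q))" for q
  have "hereditary_Ck sV sp k (Suc n) (ext_domain sV n U) r"
    unfolding r_def bergman_slope_def
    by (intro Vp.hereditary_Ck_add Vp.hereditary_Ck_diff Vm.hereditary_Ck_add
        Vp.hereditary_Ck_scale_const Vm.hereditary_Ck_scale_const hereditary_Ck_Tp hereditary_Ck_Tm
        hereditary_Ck_Qm dom point shift f1(1) g1(1) u1(1) hereditary_Ck_point[OF w U])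
  then have "hereditary_Ck sV sp k (Suc n) (ext_domain sV n U)
      (\<lambda>q. inv (?B (f (shift sV q)) (g (shift sV q))) (r q))"
    by (rule Suc.IH[OF shift _ _ dom]) (auto simp: ext_domain_def shift_def intro: Suc.prems(4))
  then show ?case
  proof (rule hereditary_Ck_SucI[OF c])
    fix x v t
    let ?q = "Ext x v t" and ?y = "tower_add x (tower_scale sV t v)"
    assume q: "?q \<in> ext_domain sV n U" and "x \<in> U" "?y \<in> U"
    then have bij_x: "bij (?B (f x) (g x))" and bij_y: "bij (?B (f ?y) (g ?y))"
      using bij Suc.prems(4) by blast+
    interpret B: module_hom sp sp "?B (f ?y) (g ?y)" by (rule module_hom_bergman)
    \<comment> \<open>By injectivity of \<open>B'\<close> it suffices to compare the images of both sides under \<open>B'\<close>.\<close>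
    have "?B (f ?y) (g ?y) (?w ?y - ?w x) = (u ?y - u x) - (?B (f ?y) (g ?y) (?w x) - ?B (f x) (g x) (?w x))"
      using bij_x bij_y by (simp add: B.diff bij_is_surj surj_f_inv_f)
    also have "\<dots> = sp t (r ?q)"
      by (simp add: difference_quotientD[OF u1(2) q] r_def shift_def Vp.scale_right_diff_distrib
          bergman_difference[OF difference_quotientD[OF f1(2) q] difference_quotientD[OF g1(2) q]])
    also have "\<dots> = ?B (f ?y) (g ?y) (sp t (inv (?B (f ?y) (g ?y)) (r ?q)))"
      using bij_y by (simp add: B.scale bij_is_surj surj_f_inv_f)
    finally show "?w ?y - ?w x = sp t (inv (?B (f (shift sV ?q)) (g (shift sV ?q))) (r ?q))"
      using bij_y by (simp add: bij_is_inj inj_eq shift_def)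
  qed
qed

lemma hereditary_Ck_quasi_inverse:
  assumes "\<And>x a. (x, a) \<in> \<Omega> \<Longrightarrow> bij (bergman sp sm Tp Tm x a)"
    and "continuous_on (\<Omega> \<times> UNIV) (\<lambda>((x, a), v). inv (bergman sp sm Tp Tm x a) v)"
    and "hereditary_Ck sV sp k n U f" "hereditary_Ck sV sm k n U g"
    and "\<And>p. p \<in> U \<Longrightarrow> (f p, g p) \<in> \<Omega>" and "U \<subseteq> topspace (tower_top n)"
  shows "hereditary_Ck sV sp k n U (\<lambda>p. quasi_inverse sp sm Tp Tm (f p) (g p))"
  unfolding quasi_inverse_def
  by (rule hereditary_Ck_inv_bergman[OF assms(1-4) _ assms(5,6)])
    (assumption | intro Vp.hereditary_Ck_diff hereditary_Ck_Qp assms(3,4,6))+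

lemma dual: "topological_jordan_pair sm sp Tm Tp"
  by unfold_locales (fact trilinear_m trilinear_p jordan_m jordan_p continuous_Tm continuous_Tp)+

end

section \<open>Smoothness of quasi-inversion\<close>

lemma (in C1_jordan_pair) smooth_quasi_inversion:
  "smooth_map_on (module_prod.scale sp sm) (module_prod.scale sp sm) (quasi_invertible sp sm Tp Tm)
     (\<lambda>(x, a). (quasi_inverse sp sm Tp Tm x a, quasi_inverse sm sp Tm Tp a x))"
proof -
  interpret dual: topological_jordan_pair sm sp Tm Tp by (rule dual)
  have m: "module_prod sp sm" by unfold_locales
  let ?s = "module_prod.scale sp sm" and ?Q = "quasi_invertible sp sm Tp Tm"
  \<comment> \<open>The hypothesis concerns both inverses jointly; each is recovered by inserting 0 for the argument of
    the other.\<close>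
  have cont_p: "continuous_on (?Q \<times> UNIV) (\<lambda>((x, a), v). inv (bergman sp sm Tp Tm x a) v)"
  proof -
    have "continuous_on (?Q \<times> UNIV) (\<lambda>q. (fst (fst q), snd (fst q), snd q, 0 :: 'c))"
      by (intro continuous_intros)
    from continuous_on_fst[OF continuous_on_compose2[OF continuous_inv_bergman this]]
    show ?thesis by (auto simp: image_subset_iff case_prod_unfold)
  qed
  have cont_m: "continuous_on (prod.swap ` ?Q \<times> UNIV) (\<lambda>((a, x), b). inv (bergman sm sp Tm Tp a x) b)"
  proof -
    have "continuous_on (prod.swap ` ?Q \<times> UNIV) (\<lambda>q. (snd (fst q), fst (fst q), 0 :: 'b, snd q))"
      by (intro continuous_intros)
    from continuous_on_snd[OF continuous_on_compose2[OF continuous_inv_bergman this]]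
    show ?thesis by (auto simp: image_subset_iff case_prod_unfold)
  qed
  have "hereditary_Ck ?s ?s k 0 (Base ` ?Q) (\<lambda>p. (quasi_inverse sp sm Tp Tm (fst (base p)) (snd (base p)),
           quasi_inverse sm sp Tm Tp (snd (base p)) (fst (base p))))" for k
  proof -
    have c: "continuous_map (tower_top 0) euclidean (\<lambda>p. fst (base p))"
      "continuous_map (tower_top 0) euclidean (\<lambda>p. snd (base p))"
      using continuous_map_compose_continuous_on[of "tower_top 0" UNIV base UNIV fst]
        continuous_map_compose_continuous_on[of "tower_top 0" UNIV base UNIV snd]
      by (simp_all add: continuous_map_base continuous_on_fst continuous_on_snd continuous_on_id)
    have f: "hereditary_Ck ?s sp k 0 (Base ` ?Q) (\<lambda>p. fst (base p))"
      by (rule hereditary_Ck_linear[OF c(1)]) (auto simp: module_prod.scale_def[OF m])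
    have g: "hereditary_Ck ?s sm k 0 (Base ` ?Q) (\<lambda>p. snd (base p))"
      by (rule hereditary_Ck_linear[OF c(2)]) (auto simp: module_prod.scale_def[OF m])
    show ?thesis
    proof (rule hereditary_Ck_Pair[OF _ _ m])
      show "hereditary_Ck ?s sp k 0 (Base ` ?Q) (\<lambda>p. quasi_inverse sp sm Tp Tm (fst (base p)) (snd (base p)))"
        by (rule hereditary_Ck_quasi_inverse[OF _ cont_p f g]) (auto simp: quasi_invertible_def)
      show "hereditary_Ck ?s sm k 0 (Base ` ?Q) (\<lambda>p. quasi_inverse sm sp Tm Tp (snd (base p)) (fst (base p)))"
        by (rule dual.hereditary_Ck_quasi_inverse[OF _ cont_m g f]) (auto simp: quasi_invertible_def)
    qed
  qed
  then show ?thesis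
    unfolding smooth_map_on_def Ck_on_def case_prod_unfold
    by (blast intro: hereditary_Ck_imp_tower_Ck)
qed

lemma (in C2_jordan_pair) smooth_partial_quasi_inversion:
  "smooth_map_on sp sp (quasi_invertible_at sp sm Tp Tm a) (\<lambda>x. quasi_inverse sp sm Tp Tm x a)"
proof -
  let ?U = "quasi_invertible_at sp sm Tp Tm a"
  have cont: "continuous_on ((?U \<times> {a}) \<times> UNIV) (\<lambda>((x, a), v). inv (bergman sp sm Tp Tm x a) v)"
  proof -
    have "continuous_on ((?U \<times> {a}) \<times> UNIV) (\<lambda>q. (fst (fst q), snd q))"
      by (intro continuous_intros)
    from continuous_on_compose2[OF continuous_inv_bergman_p[of a] this]
    have "continuous_on ((?U \<times> {a}) \<times> UNIV) (\<lambda>q. inv (bergman sp sm Tp Tm (fst (fst q)) a) (snd q))"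
      by (auto simp: image_subset_iff case_prod_unfold)
    then show ?thesis by (rule continuous_on_eq) auto
  qed
  have "hereditary_Ck sp sp k 0 (Base ` ?U) (\<lambda>p. quasi_inverse sp sm Tp Tm (base p) a)" for k
  proof (rule hereditary_Ck_quasi_inverse[OF _ cont])
    show "hereditary_Ck sp sp k 0 (Base ` ?U) base"
      by (rule hereditary_Ck_linear[OF continuous_map_base]) auto
    show "hereditary_Ck sp sm k 0 (Base ` ?U) (\<lambda>_. a)"
      by (rule Vm.hereditary_Ck_const)
  qed (auto simp: quasi_invertible_at_def quasi_invertible_def)
  then show ?thesis
    unfolding smooth_map_on_def Ck_on_def by (blast intro: hereditary_Ck_imp_tower_Ck)
qed

lemma (in C2_jordan_pair) C2_dual: "C2_jordan_pair sm sp Tm Tp"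
  by (intro C2_jordan_pair.intro C2_jordan_pair_axioms.intro dual open_quasi_invertible_at_m
      continuous_inv_bergman_m open_quasi_invertible_at_p continuous_inv_bergman_p)

theorem proposition5p2:
  fixes sp :: "'k::{comm_ring_1,topological_ab_group_add,topological_semigroup_mult} \<Rightarrow>
      'p::{topological_ab_group_add,t2_space} \<Rightarrow> 'p"
    and sm :: "'k \<Rightarrow> 'm::{topological_ab_group_add,t2_space} \<Rightarrow> 'm"
    and Tp :: "'p \<Rightarrow> 'm \<Rightarrow> 'p \<Rightarrow> 'p"
    and Tm :: "'m \<Rightarrow> 'p \<Rightarrow> 'm \<Rightarrow> 'm"
  shows
    "(C1_jordan_pair sp sm Tp Tm \<longrightarrow>
        smooth_map_on (module_prod.scale sp sm) (module_prod.scale sp sm)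
          (quasi_invertible sp sm Tp Tm)
          (\<lambda>(x, a). (quasi_inverse sp sm Tp Tm x a, quasi_inverse sm sp Tm Tp a x))) \<and>
     (C2_jordan_pair sp sm Tp Tm \<longrightarrow>
        (\<forall>a. smooth_map_on sp sp (quasi_invertible_at sp sm Tp Tm a)
               (\<lambda>x. quasi_inverse sp sm Tp Tm x a)) \<and>
        (\<forall>x. smooth_map_on sm sm (quasi_invertible_at sm sp Tm Tp x)
               (\<lambda>a. quasi_inverse sm sp Tm Tp a x)))"
  using C1_jordan_pair.smooth_quasi_inversion C2_jordan_pair.smooth_partial_quasi_inversion
    C2_jordan_pair.smooth_partial_quasi_inversion[OF C2_jordan_pair.C2_dual]
  by blast

end
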